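(* Let $j\in\{2,3,4\}$, $\lambda\in\{1,-1\}$, let $r>0$ be constant, and let $\beta$ be a unit-speed spacelike curve in $\mathbb{E}^4_1$ with non-null Frenet frame $\{F_1,F_2,F_3,F_4\}$ whose timelike member is $F_j$. Let $M$ be the tubular hypersurface $$\mathcal{T}^{\{j,\lambda\}}(s,t,w)=\beta(s)+r\sum_{i=2}^4\mu_i^{\lambda}F_i(s)$$ with Gauss map $N^{\{j,\lambda\}}=-(-1)^{(4-j)!}\lambda^j\sum_{i=2}^4\mu_i^\lambda F_i$. Then $M$ does not have second kind $\mathcal{L}_2$-pointwise 1-type Gauss map; that is, there do not exist a non-zero smooth function $\mathfrak{m}$ on $M$ and a non-zero constant vector $C\in\mathbb{E}^4_1$ such that $\mathcal{L}_2N^{\{j,\lambda\}}=\mathfrak{m}(N^{\{j,\lambda\}}+C)$.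
   Context: $\mathbb{E}^4_1$ is $\mathbb{R}^4$ with the metric $\langle\ ,\ \rangle=-dx_1^2+dx_2^2+dx_3^2+dx_4^2$. The curve $\beta:I\to\mathbb{E}^4_1$ ($I$ an open interval) is smooth with $\beta'=F_1$, and $\{F_1,\dots,F_4\}$ is a smooth orthonormal frame along $\beta$ with $\langle F_j,F_j\rangle=-1$ and $\langle F_i,F_i\rangle=1$ for $i\neq j$, satisfying, with smooth curvature functions $k_1,k_2,k_3$ of $s$, the Frenet equations - $j=2$: $F_1'=k_1F_2$, $F_2'=k_1F_1+k_2F_3$, $F_3'=k_2F_2+k_3F_4$, $F_4'=-k_3F_3$; - $j=3$: $F_1'=k_1F_2$, $F_2'=-k_1F_1+k_2F_3$, $F_3'=k_2F_2+k_3F_4$, $F_4'=k_3F_3$; - $j=4$: $F_1'=k_1F_2$, $F_2'=-k_1F_1+k_2F_3$, $F_3'=-k_2F_2+k_3F_4$, $F_4'=k_3F_3$. The functions $\mu_i^\lambda$ (depending on $j$) are given by $\mu_j^\lambda=(\sinh w)^{\frac{1+\lambda}2}(\cosh w)^{\frac{1-\lambda}2}\cosh t$, $\mu_{j+1}^\lambda=(\sinh w)^{\frac{1-\lambda}2}(\cosh w)^{\frac{1+\lambda}2}$, $\mu_{j+2}^\lambda=(\sinh w)^{\frac{1+\lambda}2}(\cosh w)^{\frac{1-\lambda}2}\sinh t$, with the index convention $\mu_5^\lambda=\mu_2^\lambda$, $\mu_6^\lambda=\mu_3^\lambda$. ($\lambda=1$: envelope of pseudo hyperspheres; $\lambda=-1$: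 envelope of pseudo hyperbolic hyperspheres, of radius $r$ centered on $\beta$.) The parameters $(s,t,w)$ range over a connected open set $U\subset I\times\mathbb{R}^2$ projecting onto $I$ on which $\mathcal{T}^{\{j,\lambda\}}$ is an immersion, i.e. $(\mu_{j+1}^\lambda)_w\neq0$ and $1+(-1)^{(4-j)!}rk_1\mu_2^\lambda\neq0$. The unit normal $N=N^{\{j,\lambda\}}$ has $\varepsilon=\langle N,N\rangle=\lambda$, and the principal curvatures with respect to $N$ (eigenvalues of $-dN$) are $\kappa_1=\kappa_2=\frac{(-1)^{(4-j)!}\lambda^j}{r}$, $\kappa_3=\frac{k_1\mu_2^\lambda}{\lambda^j(1+(-1)^{(4-j)!}rk_1\mu_2^\lambda)}$. Operator $\mathcal{L}_2$ on the Gauss map: put $a_1=-\sum_i\kappa_i$, $a_k=(-1)^k\sum_{i_1<\dots<i_k}\kappa_{i_1}\cdots\kappa_{i_k}$ ($k=2,3$), and define $H_k$ by $\binom{3}{k}H_k=(-\varepsilon)^ka_k$. Then $$\mathcal{L}_2N=-\varepsilon\,\mathfrak{C}_2\big(\nabla H_3+3H_1H_3\,N\big),\qquad \mathfrak{C}_2=\binom33(-\varepsilon)^2=1,$$ where $\nabla$ is the gradient on $M$ with respect to the induced metric, viewed as an $\mathbb{E}^4_1$-valued map. "Non-zero function" means not identically zero. *)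

theory Defs
  imports "HOL-Analysis.Analysis"
begin

section \<open>Smooth functions on open sets\<close>

text \<open>To be used on open sets only.\<close>

primrec times_differentiable_on ::
    "nat \<Rightarrow> ('a::real_normed_vector \<Rightarrow> 'b::real_normed_vector) \<Rightarrow> 'a set \<Rightarrow> bool" where
  "times_differentiable_on 0 f S \<longleftrightarrow> continuous_on S f"
| "times_differentiable_on (Suc n) f S \<longleftrightarrow>
     (\<forall>x\<in>S. f differentiable (at x)) \<and>
     (\<forall>v. times_differentiable_on n (\<lambda>x. frechet_derivative f (at x) v) S)"

definition smooth_on :: "'a set \<Rightarrow> ('a::real_normed_vector \<Rightarrow> 'b::real_normed_vector) \<Rightarrow> bool" where
  "smooth_on S f \<longleftrightarrow> (\<forall>n. times_differentiable_on n f S)"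


section \<open>Hypersurfaces of Minkowski 4-space\<close>

definition mink :: "real^4 \<Rightarrow> real^4 \<Rightarrow> real" where
  "mink x y = - (x$1 * y$1) + x$2 * y$2 + x$3 * y$3 + x$4 * y$4"

definition partial :: "(real^3 \<Rightarrow> 'b::real_normed_vector) \<Rightarrow> 3 \<Rightarrow> real^3 \<Rightarrow> 'b" where
  "partial f i p = frechet_derivative f (at p) (axis i 1)"

text \<open>Throughout, \<open>X\<close> is a parametrised hypersurface and \<open>N\<close> its Gauss map, both as functions of
  the parameters; functions on the (not necessarily embedded) hypersurface are likewise
  functions of the parameters.\<close>

definition immersion_on :: "(real^3) set \<Rightarrow> (real^3 \<Rightarrow> real^4) \<Rightarrow> bool" where
  "immersion_on U X \<longleftrightarrow> smooth_on U X \<and> (\<forall>p\<in>U. inj (frechet_derivative X (at p)))"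

text \<open>The gradient of \<open>f\<close> for the induced metric, as a vector of the ambient space.
  It is well defined where \<open>X\<close> is an immersion with non-degenerate induced metric.\<close>

definition grad :: "(real^3 \<Rightarrow> real^4) \<Rightarrow> (real^3 \<Rightarrow> real) \<Rightarrow> real^3 \<Rightarrow> real^4" where
  "grad X f p = (THE v. v \<in> range (frechet_derivative X (at p)) \<and>
                        (\<forall>i. mink v (partial X i p) = partial f i p))"

text \<open>The matrix of the shape operator \<open>-dN\<close> in the basis of the tangent space given by the
  partial derivatives of \<open>X\<close>.\<close>

definition shape_matrix :: "(real^3 \<Rightarrow> real^4) \<Rightarrow> (real^3 \<Rightarrow> real^4) \<Rightarrow> real^3 \<Rightarrow> real^3^3" where
  "shape_matrix X N p =
     (THE A. \<forall>j. - partial N j p = (\<Sum>i\<in>UNIV. A$i$j *\<^sub>R partial X i p))"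

text \<open>The eigenvalues of the shape operator, listed with algebraic multiplicity. Their order is
  unspecified; only symmetric functions of them are used below.\<close>

definition principal_curvatures ::
    "(real^3 \<Rightarrow> real^4) \<Rightarrow> (real^3 \<Rightarrow> real^4) \<Rightarrow> real^3 \<Rightarrow> 3 \<Rightarrow> real" where
  "principal_curvatures X N p =
     (SOME \<kappa>. \<forall>x. det (mat x - shape_matrix X N p) = (\<Prod>i\<in>UNIV. x - \<kappa> i))"

definition curv_coeff :: "(real^3 \<Rightarrow> real^4) \<Rightarrow> (real^3 \<Rightarrow> real^4) \<Rightarrow> nat \<Rightarrow> real^3 \<Rightarrow> real" where
  "curv_coeff X N k p =
     (-1)^k * (\<Sum>A | card A = k. \<Prod>i\<in>A. principal_curvatures X N p i)"

definition mean_curv :: "(real^3 \<Rightarrow> real^4) \<Rightarrow> (real^3 \<Rightarrow> real^4) \<Rightarrow> nat \<Rightarrow> real^3 \<Rightarrow> real" where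
  "mean_curv X N k p = (- mink (N p) (N p))^k * curv_coeff X N k p / real (3 choose k)"

definition L2_gauss :: "(real^3 \<Rightarrow> real^4) \<Rightarrow> (real^3 \<Rightarrow> real^4) \<Rightarrow> real^3 \<Rightarrow> real^4" where
  "L2_gauss X N p =
     (let \<epsilon> = mink (N p) (N p); C\<^sub>2 = real (3 choose 3) * (- \<epsilon>)\<^sup>2
      in (- \<epsilon> * C\<^sub>2) *\<^sub>R
           (grad X (mean_curv X N 3) p + (3 * mean_curv X N 1 p * mean_curv X N 3 p) *\<^sub>R N p))"

definition second_kind_L2_pointwise_1_type ::
    "(real^3) set \<Rightarrow> (real^3 \<Rightarrow> real^4) \<Rightarrow> (real^3 \<Rightarrow> real^4) \<Rightarrow> bool" where
  "second_kind_L2_pointwise_1_type U X N \<longleftrightarrow>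
     (\<exists>m :: real^3 \<Rightarrow> real. \<exists>C :: real^4.
        smooth_on U m \<and> (\<exists>p\<in>U. m p \<noteq> 0) \<and> C \<noteq> 0 \<and>
        (\<forall>p\<in>U. L2_gauss X N p = m p *\<^sub>R (N p + C)))"


section \<open>Spacelike curves with non-null Frenet frame\<close>

text \<open>\<open>F 1, \<dots>, F 4\<close> is the frame, \<open>k 1, k 2, k 3\<close> are the curvatures and \<open>F j\<close> is timelike.
  That the curve is spacelike and of unit speed is contained in \<open>\<beta>' = F 1\<close>.\<close>

definition frenet_curve ::
    "nat \<Rightarrow> real set \<Rightarrow> (real \<Rightarrow> real^4) \<Rightarrow> (nat \<Rightarrow> real \<Rightarrow> real^4) \<Rightarrow> (nat \<Rightarrow> real \<Rightarrow> real) \<Rightarrow> bool"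
where
  "frenet_curve j I \<beta> F k \<longleftrightarrow>
     smooth_on I \<beta> \<and> (\<forall>a\<in>{1..4}. smooth_on I (F a)) \<and> (\<forall>a\<in>{1..3}. smooth_on I (k a)) \<and>
     (\<forall>s\<in>I.
        (\<forall>a\<in>{1..4}. \<forall>b\<in>{1..4}.
           mink (F a s) (F b s) = (if a \<noteq> b then 0 else if a = j then -1 else 1)) \<and>
        (\<beta> has_vector_derivative F 1 s) (at s) \<and>
        (F 1 has_vector_derivative k 1 s *\<^sub>R F 2 s) (at s) \<and>
        (j = 2 \<longrightarrow>
           (F 2 has_vector_derivative k 1 s *\<^sub>R F 1 s + k 2 s *\<^sub>R F 3 s) (at s) \<and>
           (F 3 has_vector_derivative k 2 s *\<^sub>R F 2 s + k 3 s *\<^sub>R F 4 s) (at s) \<and>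
           (F 4 has_vector_derivative - k 3 s *\<^sub>R F 3 s) (at s)) \<and>
        (j = 3 \<longrightarrow>
           (F 2 has_vector_derivative - k 1 s *\<^sub>R F 1 s + k 2 s *\<^sub>R F 3 s) (at s) \<and>
           (F 3 has_vector_derivative k 2 s *\<^sub>R F 2 s + k 3 s *\<^sub>R F 4 s) (at s) \<and>
           (F 4 has_vector_derivative k 3 s *\<^sub>R F 3 s) (at s)) \<and>
        (j = 4 \<longrightarrow>
           (F 2 has_vector_derivative - k 1 s *\<^sub>R F 1 s + k 2 s *\<^sub>R F 3 s) (at s) \<and>
           (F 3 has_vector_derivative - k 2 s *\<^sub>R F 2 s + k 3 s *\<^sub>R F 4 s) (at s) \<and>
           (F 4 has_vector_derivative k 3 s *\<^sub>R F 3 s) (at s)))"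


section \<open>Tubular hypersurfaces\<close>

text \<open>The indices 2, 3, 4 are taken cyclically: 5 stands for 2 and 6 for 3.\<close>

definition cyc :: "nat \<Rightarrow> nat" where
  "cyc i = (if i > 4 then i - 3 else i)"

text \<open>For \<open>lam = 1\<close> or \<open>lam = -1\<close> the integer exponents below are exactly 0 or 1, so that
  negative values of \<open>sinh w\<close> cause no problem.\<close>

definition mu :: "nat \<Rightarrow> int \<Rightarrow> nat \<Rightarrow> real \<Rightarrow> real \<Rightarrow> real" where
  "mu j lam i t w =
     (if i = j then
        sinh w powi ((1 + lam) div 2) * cosh w powi ((1 - lam) div 2) * cosh t
      else if i = cyc (j + 1) then
        sinh w powi ((1 - lam) div 2) * cosh w powi ((1 + lam) div 2)
      else if i = cyc (j + 2) then
        sinh w powi ((1 + lam) div 2) * cosh w powi ((1 - lam) div 2) * sinh t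
      else 0)"

text \<open>The parameters \<open>(s, t, w)\<close> are the components of \<open>p\<close>.\<close>

definition tube ::
    "nat \<Rightarrow> int \<Rightarrow> real \<Rightarrow> (real \<Rightarrow> real^4) \<Rightarrow> (nat \<Rightarrow> real \<Rightarrow> real^4) \<Rightarrow> real^3 \<Rightarrow> real^4" where
  "tube j lam r \<beta> F p =
     \<beta> (p$1) + r *\<^sub>R (\<Sum>i=2..4. mu j lam i (p$2) (p$3) *\<^sub>R F i (p$1))"

definition tube_normal ::
    "nat \<Rightarrow> int \<Rightarrow> (nat \<Rightarrow> real \<Rightarrow> real^4) \<Rightarrow> real^3 \<Rightarrow> real^4" where
  "tube_normal j lam F p =
     (- ((-1) ^ fact (4 - j)) * real_of_int lam ^ j) *\<^sub>R
       (\<Sum>i=2..4. mu j lam i (p$2) (p$3) *\<^sub>R F i (p$1))"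

end

theory Submission
  imports Defs
begin

text \<open>
  Pairing \<open>L2_gauss X N = m *\<^sub>R (N + C)\<close> with tangent vectors kills the normal terms and leaves
  \<open>-\<epsilon> dH\<^sub>3 = m dh\<close>, where \<open>h = \<langle>C, X\<rangle>\<close>; only \<open>H\<^sub>3 = -\<epsilon> \<sigma> u / (r\<^sup>2 (1 + r u))\<close> is needed, where
  \<open>u\<close> is the tangential component of the derivative of the unit normal field along the curve. Hence
  \<open>du\<close> and \<open>dh\<close> are proportional where \<open>m \<noteq> 0\<close>. The functions of \<open>(t, w)\<close> involved are combinations of
  \<open>1\<close> and the three coordinates of a unit quadric, which are linearly independent on open sets.
  Comparing coefficients, \<open>C\<close> is, near a point with \<open>k 1 \<noteq> 0\<close>, a nonzero multiple \<open>\<rho>\<close> of the principal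
  normal and in particular orthogonal to the tangent \<open>F 1\<close>; differentiating this orthogonality along
  the curve gives \<open>\<rho> (k 1)\<^sup>2 = 0\<close>. If \<open>k 1\<close> vanishes wherever \<open>m \<noteq> 0\<close>, then \<open>L2_gauss X N = 0\<close>
  there, so \<open>N = -C\<close> is constant on an open set, which is impossible.\<close>

section \<open>The Minkowski product\<close>

lemma mink_add_left: "mink (x + y) z = mink x z + mink y z"
  by (simp add: mink_def algebra_simps)

lemma mink_add_right: "mink x (y + z) = mink x y + mink x z"
  by (simp add: mink_def algebra_simps)

lemma mink_diff_right: "mink x (y - z) = mink x y - mink x z"
  by (simp add: mink_def algebra_simps)

lemma mink_scaleR_left: "mink (c *\<^sub>R x) y = c * mink x y"
  by (simp add: mink_def algebra_simps)

lemma mink_scaleR_right: "mink x (c *\<^sub>R y) = c * mink x y"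
  by (simp add: mink_def algebra_simps)

lemma mink_commute: "mink x y = mink y x"
  by (simp add: mink_def algebra_simps)

lemma mink_zero [simp]: "mink 0 x = 0" "mink x 0 = 0"
  by (simp_all add: mink_def)

lemmas mink_simps = mink_add_left mink_add_right mink_scaleR_left mink_scaleR_right

lemma bounded_linear_mink: "bounded_linear (mink x)"
  by (simp add: linear_conv_bounded_linear [symmetric] linear_iff mink_add_right mink_scaleR_right)

lemma has_derivative_component_comp:
  fixes f :: "real \<Rightarrow> 'b::real_normed_vector" and q :: "real^'n"
  assumes "(f has_vector_derivative f') (at (q $ i))"
  shows "((\<lambda>q. f (q $ i)) has_derivative (\<lambda>h. h $ i *\<^sub>R f')) (at q)"
  using has_derivative_compose [OF bounded_linear_imp_has_derivative [OF bounded_linear_vec_nth]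
      assms [unfolded has_vector_derivative_def]]
  by simp

lemma partial_eqI: "(f has_derivative f') (at p) \<Longrightarrow> partial f i p = f' (axis i 1)"
  using frechet_derivative_at [of f f' p] by (simp add: partial_def)

text \<open>The first three hypotheses say that the cross product of the two triples vanishes; the
  factor is a quotient of entries at a nonzero coordinate of the first triple.\<close>

lemma parallel_coordinates:
  fixes x y z :: real
  assumes "x * y' = y * x'" "y * z' = z * y'" "x * z' = z * x'" "\<not> (x = 0 \<and> y = 0 \<and> z = 0)"
  obtains \<rho> where "x' = \<rho> * x" "y' = \<rho> * y" "z' = \<rho> * z"
proof -
  consider "x \<noteq> 0" | "y \<noteq> 0" | "z \<noteq> 0"
    using assms by blast
  then show ?thesis
  proof cases
    case 1
    then show ?thesis
      using that [of "x' / x"] assms by (simp add: field_simps)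
  next
    case 2
    then show ?thesis
      using that [of "y' / y"] assms by (simp add: field_simps)
  next
    case 3
    then show ?thesis
      using that [of "z' / z"] assms by (simp add: field_simps)
  qed
qed

text \<open>Serves to differentiate identities that hold only on a small parameter box.\<close>

lemma has_real_derivative_zero_of_ball:
  fixes f :: "real \<Rightarrow> real"
  assumes "\<And>x. \<bar>x - a\<bar> < d \<Longrightarrow> f x = 0" "(f has_real_derivative D) (at a)" "d > 0"
  shows "D = 0"
proof -
  have "((\<lambda>x. 0) has_real_derivative D) (at a)"
    by (rule has_field_derivative_transform_within [OF assms(2) \<open>d > 0\<close>])
      (use assms in \<open>auto simp: dist_real_def\<close>)
  then show ?thesis
    using DERIV_const DERIV_unique by blast
qed

text \<open>After cancelling \<open>c\<close> this is a linear system in \<open>x\<close> and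
  \<open>z\<close> of determinant \<open>(sinh t)^2 - (cosh t)^2 = -1\<close>.\<close>

lemma hyp_combination_zero:
  fixes t c x z :: real
  assumes "c * (x * sinh t + z * cosh t) = 0" "c * (x * cosh t + z * sinh t) = 0" "c \<noteq> 0"
  shows "x = 0 \<and> z = 0"
proof -
  have e: "x * sinh t + z * cosh t = 0" "x * cosh t + z * sinh t = 0"
    using assms by auto
  have "x * ((cosh t)\<^sup>2 - (sinh t)\<^sup>2) = cosh t * (x * cosh t + z * sinh t) - sinh t * (x * sinh t + z * cosh t)"
    "z * ((cosh t)\<^sup>2 - (sinh t)\<^sup>2) = cosh t * (x * sinh t + z * cosh t) - sinh t * (x * cosh t + z * sinh t)"
    by (simp_all add: algebra_simps power2_eq_square)
  then show ?thesis
    using e by (simp add: cosh_square_eq)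
qed

section \<open>Independence of hyperboloid coordinates\<close>

text \<open>The two rules cover (sinh, cosh), which occurs for \<open>lam = 1\<close>, and (cosh,
  sinh), for \<open>lam = -1\<close>.\<close>

locale hyperbolic_pair =
  fixes A B :: "real \<Rightarrow> real"
  assumes dA: "(A has_real_derivative B w) (at w)"
    and dB: "(B has_real_derivative A w) (at w)"
begin

text \<open>Two derivatives in \<open>t\<close> remove \<open>a\<close> and \<open>y\<close> and
  leave the system of \<open>hyp_combination_zero\<close>; a derivative in \<open>w\<close> then
  isolates \<open>y\<close>, and finally \<open>a\<close> remains.\<close>

lemma coordinates_independent:
  assumes z: "\<And>t w. \<bar>t - t0\<bar> < d \<Longrightarrow> \<bar>w - w0\<bar> < d \<Longrightarrow>
      a + x * (A w * cosh t) + y * B w + z * (A w * sinh t) = 0"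
    and "d > 0" "A w0 \<noteq> 0"
  shows "a = 0 \<and> x = 0 \<and> y = 0 \<and> z = 0"
proof -
  \<comment> \<open>Needed at every \<open>t\<close> of the interval, because it is differentiated
    again below; hence the shrunken radius.\<close>
  have 1: "A w0 * (x * sinh t + z * cosh t) = 0" if "\<bar>t - t0\<bar> < d" for t
    by (rule has_real_derivative_zero_of_ball
        [where a = t and d = "d - \<bar>t - t0\<bar>"
          and f = "\<lambda>t. a + x * (A w0 * cosh t) + y * B w0 + z * (A w0 * sinh t)"])
      (use that z \<open>d > 0\<close> in \<open>auto intro!: derivative_eq_intros simp: algebra_simps\<close>)
  have 2: "A w0 * (x * cosh t0 + z * sinh t0) = 0"
    by (rule has_real_derivative_zero_of_ball
        [where a = t0 and d = d and f = "\<lambda>t. A w0 * (x * sinh t + z * cosh t)", OF 1])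
      (use \<open>d > 0\<close> in \<open>auto intro!: derivative_eq_intros simp: algebra_simps\<close>)
  have xz: "x = 0 \<and> z = 0"
    using hyp_combination_zero [OF 1 2] assms by simp
  have 3: "a + y * B w = 0" if "\<bar>w - w0\<bar> < d" for w
    using z [of t0 w] that xz \<open>d > 0\<close> by simp
  have "y * A w0 = 0"
    by (rule has_real_derivative_zero_of_ball [where f = "\<lambda>w. a + y * B w", OF 3])
      (use \<open>d > 0\<close> dB in \<open>auto intro!: derivative_eq_intros\<close>)
  then show ?thesis
    using xz 3 [of w0] assms by simp
qed

text \<open>The hypotheses concern the \<open>t\<close>- and \<open>w\<close>-derivatives of the
  linear form with coefficients \<open>x\<close>, \<open>y\<close>, \<open>z\<close> in the quadric
  coordinates \<open>A w * cosh t\<close>, \<open>B w\<close>, \<open>A w * sinh t\<close>.\<close>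

lemma coordinates_no_critical_open:
  assumes t: "\<And>t w. \<bar>t - t0\<bar> < d \<Longrightarrow> \<bar>w - w0\<bar> < d \<Longrightarrow> A w * (x * sinh t + z * cosh t) = 0"
    and w: "\<And>t w. \<bar>t - t0\<bar> < d \<Longrightarrow> \<bar>w - w0\<bar> < d \<Longrightarrow>
      B w * (x * cosh t + z * sinh t) + A w * y = 0"
    and "d > 0" "A w0 \<noteq> 0"
  shows "x = 0 \<and> y = 0 \<and> z = 0"
proof -
  have 2: "A w0 * (x * cosh t0 + z * sinh t0) = 0"
    by (rule has_real_derivative_zero_of_ball
        [where a = t0 and d = d and f = "\<lambda>t. A w0 * (x * sinh t + z * cosh t)", OF t])
      (use \<open>d > 0\<close> in \<open>auto intro!: derivative_eq_intros simp: algebra_simps\<close>)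
  show ?thesis
    using hyp_combination_zero [OF t 2] w [of t0 w0] assms by simp
qed

end

section \<open>Slices of open parameter sets\<close>

lemma open_contains_slice_box:
  fixes W :: "(real^3) set"
  assumes "open W" "p \<in> W"
  obtains d where "d > 0"
    "\<And>t w. \<bar>t - p$2\<bar> < d \<Longrightarrow> \<bar>w - p$3\<bar> < d \<Longrightarrow> vector [p$1, t, w] \<in> W"
proof -
  obtain e where e: "e > 0" "ball p e \<subseteq> W"
    using assms open_contains_ball by blast
  have "vector [p$1, t, w] \<in> W" if "\<bar>t - p$2\<bar> < e/2" "\<bar>w - p$3\<bar> < e/2" for t w
  proof -
    have "norm (p - vector [p$1, t, w]) \<le> (\<Sum>i\<in>UNIV. \<bar>(p - vector [p$1, t, w]) $ i\<bar>)"
      by (rule norm_le_l1_cart)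
    also have "\<dots> < e"
      using that by (simp add: sum_3 vector_3 abs_minus_commute)
    finally show ?thesis
      using e by (auto simp: dist_norm)
  qed
  then show ?thesis
    using that [of "e/2"] e by auto
qed

lemma open_contains_first_interval:
  fixes W :: "(real^3) set"
  assumes "open W" "p \<in> W"
  obtains d where "d > 0" "\<And>s. \<bar>s - p$1\<bar> < d \<Longrightarrow> vector [s, p$2, p$3] \<in> W"
proof -
  obtain e where e: "e > 0" "ball p e \<subseteq> W"
    using assms open_contains_ball by blast
  have "vector [s, p$2, p$3] \<in> W" if "\<bar>s - p$1\<bar> < e" for s
  proof -
    have "norm (p - vector [s, p$2, p$3]) \<le> (\<Sum>i\<in>UNIV. \<bar>(p - vector [s, p$2, p$3]) $ i\<bar>)"
      by (rule norm_le_l1_cart)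
    also have "\<dots> < e"
      using that by (simp add: sum_3 vector_3 abs_minus_commute)
    finally show ?thesis
      using e by (auto simp: dist_norm)
  qed
  then show ?thesis
    using that e by auto
qed

section \<open>The Gauss-Kronecker curvature\<close>

lemma prod_3: "(\<Prod>i\<in>(UNIV::3 set). f i) = f 1 * f 2 * (f 3 :: 'a::comm_monoid_mult)"
  unfolding UNIV_3 by (simp add: ac_simps)

text \<open>Injectivity makes the matrix of the shape operator unique; being lower triangular, it
  has its diagonal entries as eigenvalues. The two signs \<open>(-1)^3\<close> cancel.\<close>

lemma mean_curv_3:
  assumes ind: "inj (frechet_derivative X (at p))"
    and X: "(X has_derivative X') (at p)"
    and A: "\<And>j. - partial N j p = (\<Sum>i\<in>UNIV. A$i$j *\<^sub>R partial X i p)"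
    and low: "A$1$2 = 0" "A$1$3 = 0" "A$2$3 = 0"
  shows "mean_curv X N 3 p = (mink (N p) (N p))^3 * (A$1$1 * A$2$2 * A$3$3)"
proof -
  have X': "frechet_derivative X (at p) = X'"
    using frechet_derivative_at [OF X] by simp
  have lin: "linear X'"
    using X has_derivative_linear by blast
  have inj: "inj X'"
    using ind X' by simp
  have comb: "(\<Sum>i\<in>UNIV. v$i *\<^sub>R partial X i p) = X' v" for v
  proof -
    have "X' v = X' (\<Sum>i\<in>UNIV. v$i *\<^sub>R axis i 1)"
      using basis_expansion [of v] by (simp add: scalar_mult_eq_scaleR)
    also have "\<dots> = (\<Sum>i\<in>UNIV. v$i *\<^sub>R X' (axis i 1))"
      by (simp add: linear_sum [OF lin] linear_scale [OF lin])
    finally show ?thesis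
      by (simp add: partial_def X')
  qed
  have shape: "shape_matrix X N p = A"
    unfolding shape_matrix_def
  proof (rule the_equality)
    show "\<forall>j. - partial N j p = (\<Sum>i\<in>UNIV. A$i$j *\<^sub>R partial X i p)"
      using A by simp
  next
    fix A' :: "real^3^3"
    assume "\<forall>j. - partial N j p = (\<Sum>i\<in>UNIV. A'$i$j *\<^sub>R partial X i p)"
    then have "X' (\<chi> i. A'$i$j) = X' (\<chi> i. A$i$j)" for j
      using A comb [of "\<chi> i. A'$i$j"] comb [of "\<chi> i. A$i$j"] by simp
    then have "(\<chi> i. A'$i$j) = (\<chi> i. A$i$j)" for j
      using inj by (simp add: inj_eq)
    then show "A' = A"
      by (simp add: vec_eq_iff)
  qed
  have "\<forall>x. det (mat x - A) = (\<Prod>i\<in>UNIV. x - A$i$i)"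
    using low by (simp add: det_3 prod_3 mat_def)
  then have "\<forall>x. det (mat x - A) = (\<Prod>i\<in>UNIV. x - principal_curvatures X N p i)"
    unfolding principal_curvatures_def shape by (rule someI [of _ "\<lambda>i. A$i$i"])
  \<comment> \<open>At \<open>x = 0\<close> the characteristic polynomial yields the product of the
    roots, in whatever order they were chosen.\<close>
  then have "det (mat 0 - A) = (\<Prod>i\<in>UNIV. 0 - principal_curvatures X N p i)"
    by blast
  moreover have "det (mat 0 - A) = - (A$1$1 * A$2$2 * A$3$3)"
    using low by (simp add: det_3 mat_def)
  ultimately have prod: "(\<Prod>i\<in>UNIV. principal_curvatures X N p i) = A$1$1 * A$2$2 * A$3$3"
    by (simp add: prod_3)
  have "{S::3 set. card S = 3} = {UNIV}"
    using card_eq_UNIV_imp_eq_UNIV [where 'a = 3] by auto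
  then show ?thesis
    by (simp add: mean_curv_def curv_coeff_def prod)
qed

section \<open>Tubes around a framed curve\<close>

text \<open>Treats all \<open>j\<close> and \<open>lam\<close> at once: \<open>T = F 1\<close>, the timelike vector is \<open>P = F j\<close>, and \<open>Q\<close>, \<open>R\<close> are
  its cyclic successors; \<open>{A, B} = {sinh, cosh}\<close>. Of \<open>kP\<close>, \<open>kQ\<close>, \<open>kR\<close> only the one belonging to \<open>F 2\<close>
  is nonzero, with value \<open>k 1\<close> or \<open>- k 1\<close>; all that matters is \<open>nonnull\<close>.\<close>

locale framed_tube = hyperbolic_pair A B for A B :: "real \<Rightarrow> real" +
  fixes I :: "real set" and U :: "(real^3) set"
    and r \<sigma> \<epsilon> :: real
    and \<beta> T P Q R :: "real \<Rightarrow> real^4"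
    and kP kQ kR kP' kQ' kR' \<omega>PQ \<omega>PR \<omega>QR :: "real \<Rightarrow> real"
  assumes BA: "(B w)\<^sup>2 - (A w)\<^sup>2 = \<epsilon>" and eps: "\<epsilon> = 1 \<or> \<epsilon> = -1"
    and sigma: "\<sigma> * \<sigma> = 1" and r: "r > 0"
    and U: "open U" and UI: "\<And>p. p \<in> U \<Longrightarrow> p$1 \<in> I"
    and orth: "\<And>s. s \<in> I \<Longrightarrow> mink (T s) (T s) = 1" "\<And>s. s \<in> I \<Longrightarrow> mink (P s) (P s) = -1"
      "\<And>s. s \<in> I \<Longrightarrow> mink (Q s) (Q s) = 1" "\<And>s. s \<in> I \<Longrightarrow> mink (R s) (R s) = 1"
      "\<And>s. s \<in> I \<Longrightarrow> mink (T s) (P s) = 0" "\<And>s. s \<in> I \<Longrightarrow> mink (T s) (Q s) = 0"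
      "\<And>s. s \<in> I \<Longrightarrow> mink (T s) (R s) = 0" "\<And>s. s \<in> I \<Longrightarrow> mink (P s) (Q s) = 0"
      "\<And>s. s \<in> I \<Longrightarrow> mink (P s) (R s) = 0" "\<And>s. s \<in> I \<Longrightarrow> mink (Q s) (R s) = 0"
    and d\<beta>: "\<And>s. s \<in> I \<Longrightarrow> (\<beta> has_vector_derivative T s) (at s)"
    and dT: "\<And>s. s \<in> I \<Longrightarrow>
      (T has_vector_derivative kP s *\<^sub>R P s - kQ s *\<^sub>R Q s - kR s *\<^sub>R R s) (at s)"
    and dP: "\<And>s. s \<in> I \<Longrightarrow>
      (P has_vector_derivative kP s *\<^sub>R T s + \<omega>PQ s *\<^sub>R Q s + \<omega>PR s *\<^sub>R R s) (at s)"
    and dQ: "\<And>s. s \<in> I \<Longrightarrow>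
      (Q has_vector_derivative kQ s *\<^sub>R T s + \<omega>PQ s *\<^sub>R P s - \<omega>QR s *\<^sub>R R s) (at s)"
    and dR: "\<And>s. s \<in> I \<Longrightarrow>
      (R has_vector_derivative kR s *\<^sub>R T s + \<omega>PR s *\<^sub>R P s + \<omega>QR s *\<^sub>R Q s) (at s)"
    and dkP: "\<And>s. s \<in> I \<Longrightarrow> (kP has_real_derivative kP' s) (at s)"
    and dkQ: "\<And>s. s \<in> I \<Longrightarrow> (kQ has_real_derivative kQ' s) (at s)"
    and dkR: "\<And>s. s \<in> I \<Longrightarrow> (kR has_real_derivative kR' s) (at s)"
    and nonnull: "\<And>s. s \<in> I \<Longrightarrow> (kP s)\<^sup>2 = (kQ s)\<^sup>2 + (kR s)\<^sup>2 \<Longrightarrow>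
      kP s = 0 \<and> kQ s = 0 \<and> kR s = 0"
begin

definition n :: "real^3 \<Rightarrow> real^4" where
  "n p = (A (p$3) * cosh (p$2)) *\<^sub>R P (p$1) + B (p$3) *\<^sub>R Q (p$1)
    + (A (p$3) * sinh (p$2)) *\<^sub>R R (p$1)"

definition X :: "real^3 \<Rightarrow> real^4" where
  "X p = \<beta> (p$1) + r *\<^sub>R n p"

definition N :: "real^3 \<Rightarrow> real^4" where
  "N p = \<sigma> *\<^sub>R n p"

text \<open>The suffixes \<open>s\<close>, \<open>t\<close>, \<open>w\<close> mark partial
  derivatives: \<open>ns\<close>, \<open>nt\<close>, \<open>nw\<close> of \<open>n\<close> and
  \<open>us\<close>, \<open>ut\<close>, \<open>uw\<close> of \<open>u\<close>.\<close>

definition nt :: "real^3 \<Rightarrow> real^4" where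
  "nt p = (A (p$3) * sinh (p$2)) *\<^sub>R P (p$1) + (A (p$3) * cosh (p$2)) *\<^sub>R R (p$1)"

definition nw :: "real^3 \<Rightarrow> real^4" where
  "nw p = (B (p$3) * cosh (p$2)) *\<^sub>R P (p$1) + A (p$3) *\<^sub>R Q (p$1)
    + (B (p$3) * sinh (p$2)) *\<^sub>R R (p$1)"

text \<open>\<open>u\<close> is the \<open>T\<close>-component of the derivative of \<open>n\<close> in the direction of the curve.\<close>

definition u :: "real^3 \<Rightarrow> real" where
  "u p = A (p$3) * cosh (p$2) * kP (p$1) + B (p$3) * kQ (p$1) + A (p$3) * sinh (p$2) * kR (p$1)"

definition us :: "real^3 \<Rightarrow> real" where
  "us p = A (p$3) * cosh (p$2) * kP' (p$1) + B (p$3) * kQ' (p$1) + A (p$3) * sinh (p$2) * kR' (p$1)"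

definition ut :: "real^3 \<Rightarrow> real" where
  "ut p = A (p$3) * (sinh (p$2) * kP (p$1) + cosh (p$2) * kR (p$1))"

definition uw :: "real^3 \<Rightarrow> real" where
  "uw p = B (p$3) * (cosh (p$2) * kP (p$1) + sinh (p$2) * kR (p$1)) + A (p$3) * kQ (p$1)"

definition ns :: "real^3 \<Rightarrow> real^4" where
  "ns p = (A (p$3) * cosh (p$2)) *\<^sub>R (kP (p$1) *\<^sub>R T (p$1) + \<omega>PQ (p$1) *\<^sub>R Q (p$1) + \<omega>PR (p$1) *\<^sub>R R (p$1))
    + B (p$3) *\<^sub>R (kQ (p$1) *\<^sub>R T (p$1) + \<omega>PQ (p$1) *\<^sub>R P (p$1) - \<omega>QR (p$1) *\<^sub>R R (p$1))
    + (A (p$3) * sinh (p$2)) *\<^sub>R (kR (p$1) *\<^sub>R T (p$1) + \<omega>PR (p$1) *\<^sub>R P (p$1) + \<omega>QR (p$1) *\<^sub>R Q (p$1))"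

text \<open>\<open>a\<close> and \<open>b\<close> are the components of \<open>ns\<close> along
  \<open>nt\<close> and \<open>nw\<close>, see \<open>ns_eq\<close>.\<close>

definition a :: "real^3 \<Rightarrow> real" where
  "a p = \<omega>PR (p$1) - B (p$3) / A (p$3) * (\<omega>PQ (p$1) * sinh (p$2) + \<omega>QR (p$1) * cosh (p$2))"

definition b :: "real^3 \<Rightarrow> real" where
  "b p = \<omega>PQ (p$1) * cosh (p$2) + \<omega>QR (p$1) * sinh (p$2)"

section \<open>Derivatives of the normal field and the tube\<close>

lemma has_derivative_comp [derivative_intros]:
  "((\<lambda>q. A (q$3)) has_derivative (\<lambda>h. h$3 * B (p$3))) (at p)"
  "((\<lambda>q. B (q$3)) has_derivative (\<lambda>h. h$3 * A (p$3))) (at p)"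
  "((\<lambda>q. cosh (q$2)) has_derivative (\<lambda>h. h$2 * sinh (p$2))) (at p)"
  "((\<lambda>q. sinh (q$2)) has_derivative (\<lambda>h. h$2 * cosh (p$2))) (at p)" for p :: "real^3"
proof -
  have c: "((\<lambda>q. f (q$i)) has_derivative (\<lambda>h. h$i * f')) (at p)"
    if "(f has_real_derivative f') (at (p$i))" for f f' i
    using has_derivative_component_comp [of f f' p i] that
    by (simp add: has_real_derivative_iff_has_vector_derivative)
  show "((\<lambda>q. A (q$3)) has_derivative (\<lambda>h. h$3 * B (p$3))) (at p)"
    "((\<lambda>q. B (q$3)) has_derivative (\<lambda>h. h$3 * A (p$3))) (at p)"
    by (rule c dA dB)+
  show "((\<lambda>q. cosh (q$2)) has_derivative (\<lambda>h. h$2 * sinh (p$2))) (at p)"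
    "((\<lambda>q. sinh (q$2)) has_derivative (\<lambda>h. h$2 * cosh (p$2))) (at p)"
    by (rule c; auto intro!: derivative_eq_intros)+
qed

lemma has_derivative_n:
  assumes "p \<in> U"
  shows "(n has_derivative (\<lambda>h. h$1 *\<^sub>R ns p + h$2 *\<^sub>R nt p + h$3 *\<^sub>R nw p)) (at p)"
proof -
  note s = UI [OF assms]
  note [derivative_intros] = has_derivative_component_comp [OF dP [OF s]]
    has_derivative_component_comp [OF dQ [OF s]] has_derivative_component_comp [OF dR [OF s]]
  show ?thesis
    unfolding n_def ns_def nt_def nw_def
    by (rule derivative_eq_intros refl)+ (simp add: fun_eq_iff algebra_simps)
qed

lemma has_derivative_X:
  assumes "p \<in> U"
  shows "(X has_derivative
    (\<lambda>h. h$1 *\<^sub>R (T (p$1) + r *\<^sub>R ns p) + h$2 *\<^sub>R r *\<^sub>R nt p + h$3 *\<^sub>R r *\<^sub>R nw p)) (at p)"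
proof -
  note [derivative_intros] = has_derivative_component_comp [OF d\<beta> [OF UI [OF assms]]]
    has_derivative_n [OF assms]
  show ?thesis
    unfolding X_def
    by (rule derivative_eq_intros refl)+ (simp add: fun_eq_iff algebra_simps)
qed

lemma has_derivative_u:
  assumes "p \<in> U"
  shows "(u has_derivative (\<lambda>h. h$1 * us p + h$2 * ut p + h$3 * uw p)) (at p)"
proof -
  note s = UI [OF assms]
  note [derivative_intros] =
    has_derivative_component_comp [OF dkP [OF s, unfolded has_real_derivative_iff_has_vector_derivative]]
    has_derivative_component_comp [OF dkQ [OF s, unfolded has_real_derivative_iff_has_vector_derivative]]
    has_derivative_component_comp [OF dkR [OF s, unfolded has_real_derivative_iff_has_vector_derivative]]
  show ?thesis
    unfolding u_def us_def ut_def uw_def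
    by (rule derivative_eq_intros refl)+ (simp add: fun_eq_iff algebra_simps)
qed

lemma cosh_sinh: "cosh t * cosh t = 1 + sinh t * (sinh t::real)"
  using cosh_square_eq [of t] by (simp add: power2_eq_square)

lemma BB: "B w * B w = \<epsilon> + A w * A w"
  using BA [of w] by (simp add: power2_eq_square algebra_simps)

text \<open>\<open>n\<close> lies on the quadric of square \<epsilon> in the span of
  \<open>P\<close>, \<open>Q\<close>, \<open>R\<close>, by \<open>BA\<close> and
  \<open>cosh_sinh\<close>; \<open>nt\<close> and \<open>nw\<close> are tangent to that
  quadric.\<close>

lemma normal_products:
  assumes "p \<in> U"
  shows "mink (n p) (n p) = \<epsilon>" "mink (n p) (nt p) = 0" "mink (n p) (nw p) = 0"
    "mink (T (p$1)) (n p) = 0" "mink (T (p$1)) (nt p) = 0" "mink (T (p$1)) (nw p) = 0"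
    "mink (nt p) (nt p) = (A (p$3))\<^sup>2" "mink (nt p) (nw p) = 0" "mink (nw p) (nw p) = - \<epsilon>"
proof -
  note s = UI [OF assms]
  have o: "mink (P (p$1)) (T (p$1)) = 0" "mink (Q (p$1)) (T (p$1)) = 0"
    "mink (R (p$1)) (T (p$1)) = 0" "mink (Q (p$1)) (P (p$1)) = 0"
    "mink (R (p$1)) (P (p$1)) = 0" "mink (R (p$1)) (Q (p$1)) = 0"
    by (subst mink_commute, rule orth [OF s])+
  have m: "mink (x *\<^sub>R P (p$1) + y *\<^sub>R Q (p$1) + z *\<^sub>R R (p$1))
      (x' *\<^sub>R P (p$1) + y' *\<^sub>R Q (p$1) + z' *\<^sub>R R (p$1)) = - x * x' + y * y' + z * z'"
    "mink (T (p$1)) (x *\<^sub>R P (p$1) + y *\<^sub>R Q (p$1) + z *\<^sub>R R (p$1)) = 0" for x y z x' y' z'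
    by (simp_all add: mink_simps o orth [OF s])
  \<comment> \<open>The zero coefficient gives \<open>nt\<close> the shape to which \<open>m\<close>
    applies.\<close>
  have nt: "nt p = (A (p$3) * sinh (p$2)) *\<^sub>R P (p$1) + 0 *\<^sub>R Q (p$1) + (A (p$3) * cosh (p$2)) *\<^sub>R R (p$1)"
    by (simp add: nt_def)
  note cs = cosh_sinh [of "p$2"] and bb = BB [of "p$3"]
  show "mink (n p) (n p) = \<epsilon>" "mink (n p) (nt p) = 0" "mink (n p) (nw p) = 0"
    "mink (T (p$1)) (n p) = 0" "mink (T (p$1)) (nt p) = 0" "mink (T (p$1)) (nw p) = 0"
    "mink (nt p) (nt p) = (A (p$3))\<^sup>2" "mink (nt p) (nw p) = 0" "mink (nw p) (nw p) = - \<epsilon>"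
    unfolding n_def nt nw_def m by (insert cs bb, algebra+)
qed

text \<open>Apart from its \<open>T\<close>-component, \<open>ns\<close> is \<open>n\<close> moved
  by an infinitesimal rotation of the frame \<open>P\<close>, \<open>Q\<close>, \<open>R\<close>,
  hence tangent to the quadric. As \<open>nt\<close> has no \<open>Q\<close>-component,
  \<open>b\<close> is read off from \<open>Q\<close>.\<close>

lemma ns_eq:
  assumes "A (p$3) \<noteq> 0"
  shows "ns p = u p *\<^sub>R T (p$1) + a p *\<^sub>R nt p + b p *\<^sub>R nw p"
proof -
  \<comment> \<open>Substituting \<open>c * A (p$3)\<close> for \<open>B (p$3)\<close> makes the
    comparison of coefficients polynomial.\<close>
  define c where "c = B (p$3) / A (p$3)"
  have c: "B (p$3) = c * A (p$3)"
    using assms by (simp add: c_def)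
  have a: "a p = \<omega>PR (p$1) - c * (\<omega>PQ (p$1) * sinh (p$2) + \<omega>QR (p$1) * cosh (p$2))"
    by (simp add: a_def c_def)
  note cs = cosh_sinh [of "p$2"]
  have cP: "B (p$3) * \<omega>PQ (p$1) + A (p$3) * sinh (p$2) * \<omega>PR (p$1)
      = a p * (A (p$3) * sinh (p$2)) + b p * (B (p$3) * cosh (p$2))"
    unfolding a b_def c using cs by algebra
  have cQ: "A (p$3) * cosh (p$2) * \<omega>PQ (p$1) + A (p$3) * sinh (p$2) * \<omega>QR (p$1) = b p * A (p$3)"
    by (simp add: b_def algebra_simps)
  have cR: "A (p$3) * cosh (p$2) * \<omega>PR (p$1) - B (p$3) * \<omega>QR (p$1)
      = a p * (A (p$3) * cosh (p$2)) + b p * (B (p$3) * sinh (p$2))"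
    unfolding a b_def c using cs by algebra
  have "ns p = u p *\<^sub>R T (p$1)
      + (B (p$3) * \<omega>PQ (p$1) + A (p$3) * sinh (p$2) * \<omega>PR (p$1)) *\<^sub>R P (p$1)
      + (A (p$3) * cosh (p$2) * \<omega>PQ (p$1) + A (p$3) * sinh (p$2) * \<omega>QR (p$1)) *\<^sub>R Q (p$1)
      + (A (p$3) * cosh (p$2) * \<omega>PR (p$1) - B (p$3) * \<omega>QR (p$1)) *\<^sub>R R (p$1)"
    by (simp add: ns_def u_def algebra_simps)
  also have "\<dots> = u p *\<^sub>R T (p$1) + a p *\<^sub>R nt p + b p *\<^sub>R nw p"
    unfolding cP cQ cR by (simp add: nt_def nw_def algebra_simps)
  finally show ?thesis .
qed

end

section \<open>Curvature and gradient of the tube\<close>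

locale immersed_tube = framed_tube +
  assumes immersion: "p \<in> U \<Longrightarrow> inj (frechet_derivative X (at p))"
begin

lemma X_derivative_zeroD:
  fixes h :: "real^3"
  assumes "p \<in> U" "h$1 *\<^sub>R (T (p$1) + r *\<^sub>R ns p) + h$2 *\<^sub>R r *\<^sub>R nt p + h$3 *\<^sub>R r *\<^sub>R nw p = 0"
  shows "h = 0"
proof -
  have "frechet_derivative X (at p) h = frechet_derivative X (at p) 0"
    using frechet_derivative_at [OF has_derivative_X [OF assms(1)], symmetric] assms(2) by simp
  then show ?thesis
    using immersion [OF assms(1)] by (simp add: inj_eq)
qed

text \<open>Where \<open>A\<close> vanishes so does \<open>nt\<close>, and with it the
  \<open>t\<close>-derivative of \<open>X\<close>.\<close>

lemma A_nonzero: "A (p$3) \<noteq> 0" if "p \<in> U"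
proof
  assume "A (p$3) = 0"
  then have "nt p = 0"
    by (simp add: nt_def)
  then have "axis 2 1 = (0 :: real^3)"
    using X_derivative_zeroD [OF that, of "axis 2 1"] by (simp add: axis_def)
  then show False
    by (simp add: axis_eq_0_iff)
qed

lemma D_nonzero: "1 + r * u p \<noteq> 0" if "p \<in> U"
proof
  assume D: "1 + r * u p = 0"
  have "T (p$1) + r *\<^sub>R ns p - (a p * r) *\<^sub>R nt p - (b p * r) *\<^sub>R nw p = (1 + r * u p) *\<^sub>R T (p$1)"
    by (simp add: ns_eq [OF A_nonzero [OF that]] algebra_simps)
  \<comment> \<open>The entries of \<open>h\<close> cancel the \<open>nt\<close>- and
    \<open>nw\<close>-components of the \<open>s\<close>-derivative of \<open>X\<close>; only
    \<open>1 + r * u p\<close> times \<open>T\<close> is left.\<close>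
  moreover define h :: "real^3" where "h = vector [1, - a p, - b p]"
  ultimately have "h = 0"
    using X_derivative_zeroD [OF that, of h] D by (simp add: vector_3 algebra_simps)
  then have "h $ 1 = 0"
    by simp
  then show False
    by (simp add: h_def vector_3)
qed

lemma partial_X:
  assumes "p \<in> U"
  shows "partial X 1 p = (1 + r * u p) *\<^sub>R T (p$1) + (r * a p) *\<^sub>R nt p + (r * b p) *\<^sub>R nw p"
    "partial X 2 p = r *\<^sub>R nt p" "partial X 3 p = r *\<^sub>R nw p"
  by (simp_all add: partial_eqI [OF has_derivative_X [OF assms]] axis_def
      ns_eq [OF A_nonzero [OF assms]] algebra_simps)

lemma has_derivative_N:
  assumes "p \<in> U"
  shows "(N has_derivative (\<lambda>h. \<sigma> *\<^sub>R (h$1 *\<^sub>R ns p + h$2 *\<^sub>R nt p + h$3 *\<^sub>R nw p))) (at p)"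
  using has_derivative_scaleR_right [OF has_derivative_n [OF assms], of \<sigma>]
  by (simp add: N_def [abs_def])

lemma partial_N:
  assumes "p \<in> U"
  shows "partial N 1 p = \<sigma> *\<^sub>R (u p *\<^sub>R T (p$1) + a p *\<^sub>R nt p + b p *\<^sub>R nw p)"
    "partial N 2 p = \<sigma> *\<^sub>R nt p" "partial N 3 p = \<sigma> *\<^sub>R nw p"
  by (simp_all add: partial_eqI [OF has_derivative_N [OF assms]] axis_def
      ns_eq [OF A_nonzero [OF assms]] algebra_simps)

lemma eps_sq: "\<epsilon> * \<epsilon> = 1"
  using eps by auto

lemma mink_N: "p \<in> U \<Longrightarrow> mink (N p) (N p) = \<epsilon>"
  using sigma by (simp add: N_def mink_simps normal_products mult.assoc [symmetric])

text \<open>The \<open>t\<close>- and \<open>w\<close>-directions are principal with curvature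
  \<open>- \<sigma> / r\<close>, so the shape matrix \<open>S\<close> is lower triangular and only
  its first diagonal entry involves \<open>u\<close>.\<close>

lemma third_mean_curvature:
  assumes p: "p \<in> U"
  shows "mean_curv X N 3 p = - \<epsilon> * \<sigma> / r\<^sup>2 * (u p / (1 + r * u p))"
proof -
  define D where "D = 1 + r * u p"
  have D: "D \<noteq> 0"
    using D_nonzero [OF p] by (simp add: D_def)
  define S :: "real^3^3" where "S = vector [vector [- \<sigma> * u p / D, 0, 0],
    vector [- \<sigma> * a p / (r * D), - \<sigma> / r, 0], vector [- \<sigma> * b p / (r * D), 0, - \<sigma> / r]]"
  \<comment> \<open>Rests on \<open>r * u p + 1 = D\<close>; applied with \<open>c = a p\<close> and
    \<open>c = b p\<close>.\<close>
  have coef: "- \<sigma> * u p / D * (r * c) - \<sigma> * c / (r * D) * r = - \<sigma> * c" for c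
    using D r by (simp add: field_simps) (simp add: D_def algebra_simps)
  have "(- \<sigma> * u p / D) *\<^sub>R partial X 1 p + (- \<sigma> * a p / (r * D)) *\<^sub>R partial X 2 p
      + (- \<sigma> * b p / (r * D)) *\<^sub>R partial X 3 p
    = (- \<sigma> * u p / D * D) *\<^sub>R T (p$1) + (- \<sigma> * u p / D * (r * a p) - \<sigma> * a p / (r * D) * r) *\<^sub>R nt p
      + (- \<sigma> * u p / D * (r * b p) - \<sigma> * b p / (r * D) * r) *\<^sub>R nw p"
    by (simp add: partial_X [OF p] D_def [symmetric] algebra_simps)
  also have "\<dots> = - partial N 1 p"
    unfolding coef using D by (simp add: partial_N [OF p] algebra_simps)
  finally have 1: "- partial N 1 p = (- \<sigma> * u p / D) *\<^sub>R partial X 1 p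
      + (- \<sigma> * a p / (r * D)) *\<^sub>R partial X 2 p + (- \<sigma> * b p / (r * D)) *\<^sub>R partial X 3 p" ..
  have 2: "- partial N 2 p = (- \<sigma> / r) *\<^sub>R partial X 2 p" "- partial N 3 p = (- \<sigma> / r) *\<^sub>R partial X 3 p"
    using r by (simp_all add: partial_N [OF p] partial_X [OF p])
  have "- partial N j p = (\<Sum>i\<in>UNIV. S$i$j *\<^sub>R partial X i p)" for j
    using exhaust_3 [of j] 1 2 by (auto simp: S_def sum_3 vector_3)
  then have "mean_curv X N 3 p = (mink (N p) (N p))^3 * (S$1$1 * S$2$2 * S$3$3)"
    by (rule mean_curv_3 [OF immersion [OF p] has_derivative_X [OF p]])
      (simp_all add: S_def vector_3)
  also have "\<dots> = (\<epsilon> * \<epsilon> * \<epsilon>) * (- \<sigma> * u p / D * (\<sigma> * \<sigma> / r\<^sup>2))"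
    by (simp add: mink_N [OF p] S_def vector_3 power3_eq_cube power2_eq_square)
  finally show ?thesis
    by (simp add: eps_sq sigma D_def mult.commute)
qed

text \<open>\<open>u / (1 + r * u)\<close> has derivative \<open>1 / (1 + r * u)^2\<close> in
  \<open>u\<close>. The formula for the curvature holds on the open set \<open>U\<close>, which is
  enough to differentiate it there.\<close>

lemma has_derivative_third_mean_curvature:
  assumes p: "p \<in> U"
  shows "(mean_curv X N 3 has_derivative
    (\<lambda>h. - \<epsilon> * \<sigma> / r\<^sup>2 / (1 + r * u p)\<^sup>2 * (h$1 * us p + h$2 * ut p + h$3 * uw p))) (at p)"
proof -
  note [derivative_intros] = has_derivative_u [OF p]
  have D: "1 + r * u p \<noteq> 0"
    using D_nonzero [OF p] .
  define L where "L h = h$1 * us p + h$2 * ut p + h$3 * uw p" for h :: "real^3"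
  have "((\<lambda>q. - \<epsilon> * \<sigma> / r\<^sup>2 * (u q / (1 + r * u q))) has_derivative
      (\<lambda>h. - \<epsilon> * \<sigma> / r\<^sup>2 * ((L h * (1 + r * u p) - u p * (r * L h)) / ((1 + r * u p) * (1 + r * u p))))) (at p)"
    unfolding L_def by (rule derivative_eq_intros refl D)+ (simp add: fun_eq_iff)
  moreover have "L h * (1 + r * u p) - u p * (r * L h) = L h" for h
    by (simp add: algebra_simps)
  ultimately have "((\<lambda>q. - \<epsilon> * \<sigma> / r\<^sup>2 * (u q / (1 + r * u q))) has_derivative
      (\<lambda>h. - \<epsilon> * \<sigma> / r\<^sup>2 / (1 + r * u p)\<^sup>2 * L h)) (at p)"
    by (simp add: power2_eq_square)
  then show ?thesis
    unfolding L_def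
    by (rule has_derivative_transform_within_open [OF _ U p]) (simp add: third_mean_curvature)
qed

section \<open>The gradient for the induced metric\<close>

lemma mink_tangent:
  assumes p: "p \<in> U"
  shows "mink (x *\<^sub>R T (p$1) + y *\<^sub>R nt p + z *\<^sub>R nw p) (partial X 1 p)
      = x * (1 + r * u p) + r * (y * (A (p$3))\<^sup>2 * a p - \<epsilon> * z * b p)"
    "mink (x *\<^sub>R T (p$1) + y *\<^sub>R nt p + z *\<^sub>R nw p) (partial X 2 p) = r * y * (A (p$3))\<^sup>2"
    "mink (x *\<^sub>R T (p$1) + y *\<^sub>R nt p + z *\<^sub>R nw p) (partial X 3 p) = - \<epsilon> * r * z"
proof -
  have TT: "mink (T (p$1)) (T (p$1)) = 1"
    using orth UI [OF p] by simp
  have o: "mink (nt p) (T (p$1)) = 0" "mink (nw p) (T (p$1)) = 0" "mink (nw p) (nt p) = 0"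
    by (subst mink_commute, simp add: normal_products [OF p])+
  show "mink (x *\<^sub>R T (p$1) + y *\<^sub>R nt p + z *\<^sub>R nw p) (partial X 1 p)
      = x * (1 + r * u p) + r * (y * (A (p$3))\<^sup>2 * a p - \<epsilon> * z * b p)"
    "mink (x *\<^sub>R T (p$1) + y *\<^sub>R nt p + z *\<^sub>R nw p) (partial X 2 p) = r * y * (A (p$3))\<^sup>2"
    "mink (x *\<^sub>R T (p$1) + y *\<^sub>R nt p + z *\<^sub>R nw p) (partial X 3 p) = - \<epsilon> * r * z"
    by (simp_all add: partial_X [OF p] mink_simps normal_products [OF p] TT o algebra_simps)
qed

text \<open>By \<open>mink_tangent\<close> the defining equations are a triangular system: those for
  \<open>t\<close> and \<open>w\<close> fix \<open>y\<close> and \<open>z\<close>, and the one for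
  \<open>s\<close> then fixes \<open>x\<close>.\<close>

lemma grad_eq:
  fixes f :: "real^3 \<Rightarrow> real"
  assumes p: "p \<in> U"
  defines "x \<equiv> (partial f 1 p - a p * partial f 2 p - b p * partial f 3 p) / (1 + r * u p)"
    and "y \<equiv> partial f 2 p / (r * (A (p$3))\<^sup>2)"
    and "z \<equiv> - \<epsilon> * partial f 3 p / r"
  shows "grad X f p = x *\<^sub>R T (p$1) + y *\<^sub>R nt p + z *\<^sub>R nw p"
    and "mink (grad X f p) (partial X i p) = partial f i p"
proof -
  define D where "D = 1 + r * u p"
  have D: "D \<noteq> 0"
    using D_nonzero [OF p] by (simp add: D_def)
  note A0 = A_nonzero [OF p]
  have X': "frechet_derivative X (at p) h
      = (h$1 * D) *\<^sub>R T (p$1) + (r * (h$1 * a p + h$2)) *\<^sub>R nt p + (r * (h$1 * b p + h$3)) *\<^sub>R nw p" for h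
    unfolding frechet_derivative_at [OF has_derivative_X [OF p], symmetric]
    by (simp add: ns_eq [OF A0] D_def algebra_simps)
  note prods = mink_tangent [OF p, folded D_def]
  have eps2: "\<epsilon> * (\<epsilon> * c) = c" for c
    using eps_sq by (simp add: mult.assoc [symmetric])
  let ?v = "x *\<^sub>R T (p$1) + y *\<^sub>R nt p + z *\<^sub>R nw p"
  have mv: "mink ?v (partial X i p) = partial f i p" for i
  proof -
    have "x * D = partial f 1 p - a p * partial f 2 p - b p * partial f 3 p"
      using D by (simp add: x_def D_def)
    moreover have "r * y * (A (p$3))\<^sup>2 = partial f 2 p" "- \<epsilon> * r * z = partial f 3 p"
      using r A0 by (simp_all add: y_def z_def eps2 mult.assoc)
    moreover have "x * D + r * (y * (A (p$3))\<^sup>2 * a p - \<epsilon> * z * b p)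
        = x * D + a p * (r * y * (A (p$3))\<^sup>2) + b p * (- \<epsilon> * r * z)"
      by (simp add: algebra_simps)
    ultimately show ?thesis
      using exhaust_3 [of i] by (auto simp: prods)
  qed
  show "grad X f p = ?v"
    unfolding grad_def
  proof (rule the_equality)
    \<comment> \<open>The \<open>T\<close>-coefficient in \<open>X'\<close> determines the first
      entry; the other two make up for its contribution along \<open>nt\<close> and
      \<open>nw\<close>.\<close>
    have "?v = frechet_derivative X (at p) (vector [x / D, y / r - x / D * a p, z / r - x / D * b p])"
      using D r by (simp add: X' vector_3)
    then have "?v \<in> range (frechet_derivative X (at p))"
      by blast
    then show "?v \<in> range (frechet_derivative X (at p)) \<and>
        (\<forall>i. mink ?v (partial X i p) = partial f i p)"
      using mv by blast
  next
    fix v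
    assume v: "v \<in> range (frechet_derivative X (at p)) \<and> (\<forall>i. mink v (partial X i p) = partial f i p)"
    then obtain x' y' z' where v': "v = x' *\<^sub>R T (p$1) + y' *\<^sub>R nt p + z' *\<^sub>R nw p"
      using X' by auto
    have 1: "x' * D + r * (y' * (A (p$3))\<^sup>2 * a p - \<epsilon> * z' * b p) = partial f 1 p"
      and 2: "r * y' * (A (p$3))\<^sup>2 = partial f 2 p" and 3: "- \<epsilon> * r * z' = partial f 3 p"
      using v prods unfolding v' by metis+
    have "x' = x"
      using D by (simp add: x_def D_def [symmetric] 1 [symmetric] 2 [symmetric] 3 [symmetric] algebra_simps)
    moreover have "y' = y"
      using r A0 by (simp add: y_def 2 [symmetric])
    moreover have "z' = z"
      using r by (simp add: z_def 3 [symmetric] eps2 mult.assoc)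
    ultimately show "v = ?v"
      using v' by simp
  qed
  then show "mink (grad X f p) (partial X i p) = partial f i p"
    using mv by simp
qed

lemma partial_third_mean_curvature:
  assumes "p \<in> U"
  defines "c \<equiv> - \<epsilon> * \<sigma> / r\<^sup>2 / (1 + r * u p)\<^sup>2"
  shows "partial (mean_curv X N 3) 1 p = c * us p" "partial (mean_curv X N 3) 2 p = c * ut p"
    "partial (mean_curv X N 3) 3 p = c * uw p"
  by (simp_all add: partial_eqI [OF has_derivative_third_mean_curvature [OF assms(1)]] c_def axis_def)

section \<open>The tangential part of the 1-type equation\<close>

lemma mink_N_partial:
  assumes "p \<in> U"
  shows "mink (N p) (partial X i p) = 0"
proof -
  have "mink (n p) (T (p$1)) = 0"
    by (subst mink_commute) (simp add: normal_products [OF assms])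
  then show ?thesis
    using exhaust_3 [of i]
    by (auto simp: N_def partial_X [OF assms] mink_simps normal_products [OF assms])
qed

lemma L2_gauss_eq:
  assumes "p \<in> U"
  shows "L2_gauss X N p = - \<epsilon> *\<^sub>R (grad X (mean_curv X N 3) p
    + (3 * mean_curv X N 1 p * mean_curv X N 3 p) *\<^sub>R N p)"
  by (simp add: L2_gauss_def Let_def mink_N [OF assms] power2_eq_square eps_sq)

text \<open>The term along \<open>N\<close> is orthogonal to the tangent space, so the first mean
  curvature is never computed.\<close>

lemma mink_L2_gauss:
  assumes "p \<in> U"
  shows "mink (L2_gauss X N p) (partial X i p) = - \<epsilon> * partial (mean_curv X N 3) i p"
  unfolding L2_gauss_eq [OF assms] mink_scaleR_left mink_add_left
  by (simp add: grad_eq(2) [OF assms] mink_N_partial [OF assms])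

text \<open>Both sides are paired with the partial derivatives of \<open>X\<close>. The factor
  \<open>c\<close> is \<open>- \<epsilon>\<close> times the factor in
  \<open>partial_third_mean_curvature\<close>, where the two \<epsilon> cancel.\<close>

lemma tangential_equations:
  assumes p: "p \<in> U" and eq: "L2_gauss X N p = m *\<^sub>R (N p + C)"
  defines "c \<equiv> \<sigma> / r\<^sup>2 / (1 + r * u p)\<^sup>2"
  shows "c * us p = m * mink C (T (p$1) + r *\<^sub>R ns p)" "c * ut p = m * (r * mink C (nt p))"
    "c * uw p = m * (r * mink C (nw p))" "c \<noteq> 0"
proof -
  have e: "- \<epsilon> * partial (mean_curv X N 3) i p = m * mink C (partial X i p)" for i
    using mink_L2_gauss [OF p, of i] by (simp add: eq mink_simps mink_N_partial [OF p])
  have c: "- \<epsilon> * (- \<epsilon> * \<sigma> / r\<^sup>2 / (1 + r * u p)\<^sup>2 * y) = c * y" for y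
    using eps by (auto simp: c_def)
  have X1: "partial X 1 p = T (p$1) + r *\<^sub>R ns p"
    by (simp add: partial_eqI [OF has_derivative_X [OF p]] axis_def)
  show "c * us p = m * mink C (T (p$1) + r *\<^sub>R ns p)" "c * ut p = m * (r * mink C (nt p))"
    "c * uw p = m * (r * mink C (nw p))"
    using e [of 1] e [of 2] e [of 3] unfolding partial_third_mean_curvature [OF p] c X1
    by (simp_all add: partial_X [OF p] mink_simps)
  show "c \<noteq> 0"
    using sigma r D_nonzero [OF p] by (auto simp: c_def)
qed

section \<open>Linear forms on slices of constant \<open>s\<close>\<close>

lemma mink_nt: "mink C (nt p) = A (p$3) * (mink C (P (p$1)) * sinh (p$2) + mink C (R (p$1)) * cosh (p$2))"
  by (simp add: nt_def mink_simps algebra_simps)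

lemma mink_nw: "mink C (nw p) = B (p$3) * (mink C (P (p$1)) * cosh (p$2) + mink C (R (p$1)) * sinh (p$2))
    + A (p$3) * mink C (Q (p$1))"
  by (simp add: nw_def mink_simps algebra_simps)

text \<open>On such a slice \<open>u\<close> is a linear form in the quadric coordinates with
  coefficients \<open>kP\<close>, \<open>kQ\<close>, \<open>kR\<close>.\<close>

lemma curvatures_zero_if_u_critical:
  assumes W: "open W" "W \<subseteq> U" "p \<in> W"
    and crit: "\<And>t w. vector [p$1, t, w] \<in> W \<Longrightarrow>
      ut (vector [p$1, t, w]) = 0 \<and> uw (vector [p$1, t, w]) = 0"
  shows "kP (p$1) = 0 \<and> kQ (p$1) = 0 \<and> kR (p$1) = 0"
proof -
  obtain d where d: "d > 0"
    "\<And>t w. \<bar>t - p$2\<bar> < d \<Longrightarrow> \<bar>w - p$3\<bar> < d \<Longrightarrow> vector [p$1, t, w] \<in> W"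
    using open_contains_slice_box W by blast
  show ?thesis
    by (rule coordinates_no_critical_open [OF _ _ d(1) A_nonzero])
      (use d(2) crit W in \<open>fastforce simp: ut_def uw_def vector_3 algebra_simps\<close>)+
qed

text \<open>Here \<open>u = 0\<close> on \<open>W\<close>, so the third mean curvature vanishes
  together with its gradient.\<close>

lemma L2_gauss_eq_zero:
  assumes W: "open W" "W \<subseteq> U" "p \<in> W"
    and k: "\<And>q. q \<in> W \<Longrightarrow> kP (q$1) = 0 \<and> kQ (q$1) = 0 \<and> kR (q$1) = 0"
  shows "L2_gauss X N p = 0"
proof -
  have p: "p \<in> U"
    using W by blast
  have H: "mean_curv X N 3 q = 0" if "q \<in> W" for q
    using third_mean_curvature [of q] k [OF that] that W by (auto simp: u_def)
  have "(mean_curv X N 3 has_derivative (\<lambda>h. 0)) (at p)"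
    by (rule has_derivative_transform_within_open [OF has_derivative_const W(1,3)]) (simp add: H)
  then have "partial (mean_curv X N 3) i p = 0" for i
    by (rule partial_eqI)
  then show ?thesis
    by (simp add: L2_gauss_eq [OF p] grad_eq(1) [OF p] H [OF W(3)])
qed

text \<open>\<open>N\<close> moves with \<open>t\<close>: \<open>nt\<close> has square
  \<open>(A (p$3))^2\<close>, which is nonzero.\<close>

lemma N_not_constant:
  assumes W: "open W" "W \<subseteq> U" "p \<in> W" and N: "\<And>q. q \<in> W \<Longrightarrow> N q = c"
  shows False
proof -
  have p: "p \<in> U"
    using W by blast
  have "(N has_derivative (\<lambda>h. 0)) (at p)"
    by (rule has_derivative_transform_within_open [OF has_derivative_const W(1,3)]) (simp add: N)
  then have "\<sigma> *\<^sub>R nt p = 0"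
    using partial_eqI [of N _ p 2] partial_N(2) [OF p] by metis
  then have "nt p = 0"
    using sigma by auto
  then show False
    using normal_products(7) [OF p] A_nonzero [OF p] by simp
qed

text \<open>On a slice the differentials of the linear forms \<open>u\<close> and
  \<open>mink C (n q)\<close> are proportional. Eliminating the factor leaves a linear form whose
  coefficients make up a cross product, and independence kills them.\<close>

lemma normal_part_parallel:
  assumes W: "open W" "W \<subseteq> U" "p \<in> W"
    and eq: "\<And>q. q \<in> W \<Longrightarrow> m q \<noteq> 0 \<and> L2_gauss X N q = m q *\<^sub>R (N q + C)"
    and nz: "\<not> (kP (p$1) = 0 \<and> kQ (p$1) = 0 \<and> kR (p$1) = 0)"
  obtains \<rho> where "mink C (P (p$1)) = \<rho> * kP (p$1)" "mink C (Q (p$1)) = \<rho> * kQ (p$1)"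
    "mink C (R (p$1)) = \<rho> * kR (p$1)"
proof -
  obtain d where d: "d > 0"
    "\<And>t w. \<bar>t - p$2\<bar> < d \<Longrightarrow> \<bar>w - p$3\<bar> < d \<Longrightarrow> vector [p$1, t, w] \<in> W"
    using open_contains_slice_box W by blast
  define x y z where "x = kP (p$1)" and "y = kQ (p$1)" and "z = kR (p$1)"
  define x' y' z' where "x' = mink C (P (p$1))" and "y' = mink C (Q (p$1))" and "z' = mink C (R (p$1))"
  note defs = x_def [symmetric] y_def [symmetric] z_def [symmetric]
    x'_def [symmetric] y'_def [symmetric] z'_def [symmetric]
  \<comment> \<open>The summand \<open>0\<close> is the constant term \<open>a\<close> of
    \<open>coordinates_independent\<close>.\<close>
  have "0 + (z * y' - y * z') * (A w * cosh t) + (z * x' - x * z') * B w + (x * y' - y * x') * (A w * sinh t) = 0"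
    if "\<bar>t - p$2\<bar> < d" "\<bar>w - p$3\<bar> < d" for t w
  proof -
    let ?q = "vector [p$1, t, w] :: real^3"
    have q: "?q \<in> W" "?q \<in> U"
      using d(2) that W by auto
    note e = tangential_equations [OF q(2) conjunct2 [OF eq [OF q(1)]]]
    define c where "c = \<sigma> / r\<^sup>2 / (1 + r * u ?q)\<^sup>2"
    have "c * ut ?q = m ?q * (r * mink C (nt ?q))" "c * uw ?q = m ?q * (r * mink C (nw ?q))" "c \<noteq> 0"
      using e by (simp_all add: c_def)
    \<comment> \<open>Both cross products of the two equations equal \<open>(m ?q * r)^2\<close>
      times \<open>mink C (nt ?q) * mink C (nw ?q)\<close>.\<close>
    then have "c * (m ?q * r) * (ut ?q * mink C (nw ?q) - uw ?q * mink C (nt ?q)) = 0"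
      by algebra
    then have "ut ?q * mink C (nw ?q) - uw ?q * mink C (nt ?q) = 0"
      using \<open>c \<noteq> 0\<close> r eq [OF q(1)] by simp
    moreover have "ut ?q * mink C (nw ?q) - uw ?q * mink C (nt ?q) = A w *
        ((z * y' - y * z') * (A w * cosh t) + (z * x' - x * z') * B w + (x * y' - y * x') * (A w * sinh t))"
      unfolding ut_def uw_def mink_nt mink_nw vector_3 defs using cosh_sinh [of t] by algebra
    moreover have "A w \<noteq> 0"
      using A_nonzero [OF q(2)] by (simp add: vector_3)
    ultimately show ?thesis
      by simp
  qed
  then have "z * y' - y * z' = 0 \<and> z * x' - x * z' = 0 \<and> x * y' - y * x' = 0"
    using coordinates_independent [where a = 0, OF _ d(1) A_nonzero] W by blast
  then show ?thesis
    using parallel_coordinates [of x y' y x' z' z] nz that unfolding defs by auto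
qed

text \<open>Once \<rho> is known, the \<open>t\<close>- and \<open>w\<close>-equations force
  \<open>c = m * r * \<rho>\<close>, and the \<open>s\<close>-equation becomes
  \<open>mink C (partial X 1 q) = r * \<rho> * us q\<close>. On the slice this is affine in the
  quadric coordinates with constant term \<open>mink C (T s)\<close>.\<close>

lemma tangent_part_zero:
  assumes W: "open W" "W \<subseteq> U" "p \<in> W"
    and eq: "\<And>q. q \<in> W \<Longrightarrow> m q \<noteq> 0 \<and> L2_gauss X N q = m q *\<^sub>R (N q + C)"
    and crit: "\<And>q. q \<in> W \<Longrightarrow> ut q \<noteq> 0 \<or> uw q \<noteq> 0"
  obtains \<rho> where "\<rho> \<noteq> 0" "mink C (T (p$1)) = 0" "mink C (P (p$1)) = \<rho> * kP (p$1)"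
    "mink C (Q (p$1)) = \<rho> * kQ (p$1)" "mink C (R (p$1)) = \<rho> * kR (p$1)"
proof -
  have nz: "\<not> (kP (p$1) = 0 \<and> kQ (p$1) = 0 \<and> kR (p$1) = 0)"
    using crit [OF W(3)] by (auto simp: ut_def uw_def)
  obtain \<rho> where \<rho>: "mink C (P (p$1)) = \<rho> * kP (p$1)" "mink C (Q (p$1)) = \<rho> * kQ (p$1)"
    "mink C (R (p$1)) = \<rho> * kR (p$1)"
    using normal_part_parallel [OF W eq nz] by blast
  have g: "mink C (nt q) = \<rho> * ut q" "mink C (nw q) = \<rho> * uw q" if "q$1 = p$1" for q
    by (simp_all add: mink_nt mink_nw ut_def uw_def that \<rho> algebra_simps)
  \<comment> \<open>For \<open>\<rho> = 0\<close> both \<open>ut\<close> and \<open>uw\<close> would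
    vanish at \<open>p\<close>.\<close>
  have "\<rho> \<noteq> 0"
    using tangential_equations(2,3,4) [OF subsetD [OF W(2,3)] conjunct2 [OF eq [OF W(3)]]]
      crit [OF W(3)] g [OF refl] by auto
  obtain d where d: "d > 0"
    "\<And>t w. \<bar>t - p$2\<bar> < d \<Longrightarrow> \<bar>w - p$3\<bar> < d \<Longrightarrow> vector [p$1, t, w] \<in> W"
    using open_contains_slice_box W by blast
  define s where "s = p$1"
  \<comment> \<open>The coefficients of the quadric coordinates in
    \<open>h - r * \<rho> * us ?q\<close> below.\<close>
  define x y z where
    "x = r * (kP s * mink C (T s) + \<omega>PQ s * mink C (Q s) + \<omega>PR s * mink C (R s)) - r * \<rho> * kP' s"
    and "y = r * (kQ s * mink C (T s) + \<omega>PQ s * mink C (P s) - \<omega>QR s * mink C (R s)) - r * \<rho> * kQ' s"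
    and "z = r * (kR s * mink C (T s) + \<omega>PR s * mink C (P s) + \<omega>QR s * mink C (Q s)) - r * \<rho> * kR' s"
  have "mink C (T s) + x * (A w * cosh t) + y * B w + z * (A w * sinh t) = 0"
    if "\<bar>t - p$2\<bar> < d" "\<bar>w - p$3\<bar> < d" for t w
  proof -
    let ?q = "vector [p$1, t, w] :: real^3"
    have q: "?q \<in> W" "?q \<in> U"
      using d(2) that W by auto
    note e = tangential_equations [OF q(2) conjunct2 [OF eq [OF q(1)]]]
    define c where "c = \<sigma> / r\<^sup>2 / (1 + r * u ?q)\<^sup>2"
    define h where "h = mink C (T (?q$1) + r *\<^sub>R ns ?q)"
    have "c * us ?q = m ?q * h" "c * ut ?q = m ?q * (r * (\<rho> * ut ?q))"
      "c * uw ?q = m ?q * (r * (\<rho> * uw ?q))"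
      using e g [of ?q] by (simp_all add: c_def h_def vector_3)
    then have "m ?q * ut ?q * (h - r * \<rho> * us ?q) = 0" "m ?q * uw ?q * (h - r * \<rho> * us ?q) = 0"
      by algebra+
    then have "h - r * \<rho> * us ?q = 0"
      using crit [OF q(1)] eq [OF q(1)] by auto
    moreover have "h - r * \<rho> * us ?q
        = mink C (T s) + x * (A w * cosh t) + y * B w + z * (A w * sinh t)"
      by (simp add: h_def us_def ns_def x_def y_def z_def s_def vector_3 mink_simps mink_diff_right algebra_simps)
    ultimately show ?thesis
      by simp
  qed
  then have "mink C (T s) = 0"
    using coordinates_independent [OF _ d(1) A_nonzero] W by blast
  then show ?thesis
    using that \<open>\<rho> \<noteq> 0\<close> \<rho> by (simp add: s_def)
qed

text \<open>Makes the set where \<open>u\<close> is not critical along its slice open.\<close>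

lemma continuous_on_ut_uw: "continuous_on U ut" "continuous_on U uw"
proof -
  have c: "continuous_on U (\<lambda>p. f (p$i))" if "\<And>p. p \<in> U \<Longrightarrow> isCont f (p$i)"
    for f :: "real \<Rightarrow> real" and i :: 3
  proof (intro continuous_at_imp_continuous_on ballI)
    fix p assume "p \<in> U"
    have "isCont (\<lambda>p. p$i) p"
      by (intro continuous_intros)
    then show "isCont (\<lambda>p. f (p$i)) p"
      using that [OF \<open>p \<in> U\<close>] by (rule isCont_o2)
  qed
  have k: "continuous_on U (\<lambda>p. A (p$3))" "continuous_on U (\<lambda>p. B (p$3))"
    "continuous_on U (\<lambda>p. kP (p$1))" "continuous_on U (\<lambda>p. kQ (p$1))" "continuous_on U (\<lambda>p. kR (p$1))"
    by (rule c, rule DERIV_isCont, rule dA dB dkP dkQ dkR, (erule UI)?)+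
  show "continuous_on U ut" "continuous_on U uw"
    unfolding ut_def [abs_def] uw_def [abs_def] by (intro continuous_intros k)+
qed

lemma pointwise_factor_zero:
  assumes m: "continuous_on U m" and eq: "\<And>p. p \<in> U \<Longrightarrow> L2_gauss X N p = m p *\<^sub>R (N p + C)"
    and p: "p \<in> U"
  shows "m p = 0"
proof (rule ccontr)
  assume "m p \<noteq> 0"
  define W where "W = U \<inter> m -` (- {0})"
  have W: "open W" "W \<subseteq> U" "p \<in> W"
    using continuous_open_preimage [OF m U, of "- {0}"] p \<open>m p \<noteq> 0\<close> by (auto simp: W_def)
  have eqW: "m q \<noteq> 0 \<and> L2_gauss X N q = m q *\<^sub>R (N q + C)" if "q \<in> W" for q
    using that eq by (auto simp: W_def)
  show False
  proof (cases "\<forall>q\<in>W. kP (q$1) = 0 \<and> kQ (q$1) = 0 \<and> kR (q$1) = 0")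
    case True
    have "N q = - C" if "q \<in> W" for q
      using L2_gauss_eq_zero [OF W(1,2) that] True eqW [OF that] by (simp add: eq_neg_iff_add_eq_0)
    then show False
      using N_not_constant [OF W] by blast
  next
    case False
    then obtain q where q: "q \<in> W" "ut q \<noteq> 0 \<or> uw q \<noteq> 0"
      using curvatures_zero_if_u_critical [OF W(1,2)] by metis
    \<comment> \<open>On \<open>W'\<close> the noncriticality required by
      \<open>tangent_part_zero\<close> holds at every point, also for neighbouring
      \<open>s\<close>.\<close>
    define W' where "W' = W \<inter> ((U \<inter> ut -` (- {0})) \<union> (U \<inter> uw -` (- {0})))"
    have W': "open W'" "W' \<subseteq> U" "q \<in> W'"
      using W q continuous_open_preimage [OF continuous_on_ut_uw(1) U, of "- {0}"]
        continuous_open_preimage [OF continuous_on_ut_uw(2) U, of "- {0}"]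
      by (auto simp: W'_def simp del: vimage_Compl)
    have eqW': "m q \<noteq> 0 \<and> L2_gauss X N q = m q *\<^sub>R (N q + C)" and crit: "ut q \<noteq> 0 \<or> uw q \<noteq> 0"
      if "q \<in> W'" for q
      using that eqW by (auto simp: W'_def)
    note tangent = tangent_part_zero [OF W'(1,2) _ eqW' crit]
    define s where "s = q$1"
    have s: "s \<in> I"
      using UI W' by (auto simp: s_def)
    obtain \<rho> where \<rho>: "\<rho> \<noteq> 0" "mink C (P s) = \<rho> * kP s" "mink C (Q s) = \<rho> * kQ s" "mink C (R s) = \<rho> * kR s"
      unfolding s_def by (rule tangent [OF W'(3)])
    obtain d where d: "d > 0" "\<And>s'. \<bar>s' - s\<bar> < d \<Longrightarrow> vector [s', q$2, q$3] \<in> W'"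
      using open_contains_first_interval [OF W'(1,3)] unfolding s_def by blast
    \<comment> \<open>The factor \<rho> may change with \<open>s\<close>, but the vanishing of the
      tangent part holds on an interval and can be differentiated.\<close>
    have T0: "mink C (T s') = 0" if "\<bar>s' - s\<bar> < d" for s'
      by (rule tangent [OF d(2) [OF that]]) (simp_all add: vector_3)
    have D: "((\<lambda>s. mink C (T s)) has_real_derivative
        mink C (kP s *\<^sub>R P s - kQ s *\<^sub>R Q s - kR s *\<^sub>R R s)) (at s)"
      using bounded_linear.has_vector_derivative [OF bounded_linear_mink dT [OF s]]
      by (simp add: has_real_derivative_iff_has_vector_derivative)
    have "mink C (kP s *\<^sub>R P s - kQ s *\<^sub>R Q s - kR s *\<^sub>R R s) = 0"
    proof (rule has_real_derivative_zero_of_ball [OF _ D d(1)])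
      show "mink C (T s') = 0" if "\<bar>s' - s\<bar> < d" for s'
        using that by (rule T0)
    qed
    \<comment> \<open>The bracket is minus the Minkowski square of the derivative of
      \<open>T\<close>, which by \<open>nonnull\<close> vanishes only with the curvatures.\<close>
    then have "\<rho> * ((kP s)\<^sup>2 - ((kQ s)\<^sup>2 + (kR s)\<^sup>2)) = 0"
      by (simp add: mink_simps mink_diff_right \<rho> power2_eq_square algebra_simps)
    then have "(kP s)\<^sup>2 = (kQ s)\<^sup>2 + (kR s)\<^sup>2"
      using \<rho>(1) by simp
    then have "kP s = 0 \<and> kQ s = 0 \<and> kR s = 0"
      by (rule nonnull [OF s])
    then show False
      using q(2) by (simp add: ut_def uw_def s_def)
  qed
qed

end

section \<open>Tubes around Frenet curves\<close>

lemma no_second_kind_framed_tube: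
  assumes frame: "framed_tube A B I U r \<sigma> \<epsilon> \<beta> T P Q R kP kQ kR kP' kQ' kR' \<omega>PQ \<omega>PR \<omega>QR"
    and imm: "immersion_on U X"
    and X: "X = framed_tube.X A B r \<beta> P Q R" and N: "N = framed_tube.N A B \<sigma> P Q R"
  shows "\<not> second_kind_L2_pointwise_1_type U X N"
proof -
  interpret framed_tube A B I U r \<sigma> \<epsilon> \<beta> T P Q R kP kQ kR kP' kQ' kR' \<omega>PQ \<omega>PR \<omega>QR
    by (rule frame)
  interpret immersed_tube A B I U r \<sigma> \<epsilon> \<beta> T P Q R kP kQ kR kP' kQ' kR' \<omega>PQ \<omega>PR \<omega>QR
    by unfold_locales (use imm [unfolded immersion_on_def X] in blast)
  have "continuous_on U m" if "smooth_on U m" for m :: "real^3 \<Rightarrow> real"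
    using that by (metis smooth_on_def times_differentiable_on.simps(1))
  then show ?thesis
    using pointwise_factor_zero unfolding second_kind_L2_pointwise_1_type_def X N by blast
qed

lemma smooth_on_has_real_derivative:
  assumes "smooth_on I f" "s \<in> I"
  shows "(f has_real_derivative deriv f s) (at s)"
proof -
  have "times_differentiable_on (Suc 0) f I"
    using assms by (simp add: smooth_on_def)
  then show ?thesis
    using assms by (simp add: DERIV_deriv_iff_real_differentiable)
qed

lemma sum_2_to_4: "(\<Sum>i=2..4. f i) = f 2 + f 3 + (f (4::nat) :: 'a::comm_monoid_add)"
  by (simp add: numeral_eq_Suc ac_simps)

text \<open>The exponents are 1 and 0 for \<open>lam = 1\<close> and 0 and 1 for
  \<open>lam = -1\<close>, so \<open>lam\<close> merely exchanges sinh and cosh.\<close>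

lemma mu_eq:
  assumes "lam \<in> {1, -1}"
  defines "A \<equiv> (if lam = 1 then sinh else cosh)" and "B \<equiv> (if lam = 1 then cosh else sinh)"
  shows "mu 2 lam 2 t w = A w * cosh t" "mu 2 lam 3 t w = B w" "mu 2 lam 4 t w = A w * sinh t"
    "mu 3 lam 3 t w = A w * cosh t" "mu 3 lam 4 t w = B w" "mu 3 lam 2 t w = A w * sinh t"
    "mu 4 lam 4 t w = A w * cosh t" "mu 4 lam 2 t w = B w" "mu 4 lam 3 t w = A w * sinh t"
  using assms by (auto simp: mu_def cyc_def)

theorem theorem14:
  fixes j :: nat and lam :: int and r :: real
    and I :: "real set" and U :: "(real^3) set"
    and \<beta> :: "real \<Rightarrow> real^4" and F :: "nat \<Rightarrow> real \<Rightarrow> real^4" and k :: "nat \<Rightarrow> real \<Rightarrow> real"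
  assumes "j \<in> {2, 3, 4}" and "lam \<in> {1, -1}" and "r > 0"
    and "open I" and "is_interval I" and "I \<noteq> {}"
    and "frenet_curve j I \<beta> F k"
    and "open U" and "connected U" and "(\<lambda>p. p$1) ` U = I"
    and "immersion_on U (tube j lam r \<beta> F)"
  shows "\<not> second_kind_L2_pointwise_1_type U (tube j lam r \<beta> F) (tube_normal j lam F)"
proof -
  define A :: "real \<Rightarrow> real" where "A = (if lam = 1 then sinh else cosh)"
  define B :: "real \<Rightarrow> real" where "B = (if lam = 1 then cosh else sinh)"
  define \<epsilon> where "\<epsilon> = real_of_int lam"
  define \<sigma> where "\<sigma> = - ((-1) ^ fact (4 - j)) * real_of_int lam ^ j"
  note mu = mu_eq [OF assms(2), folded A_def B_def]
  have hyp: "hyperbolic_pair A B"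
    by unfold_locales (auto simp: A_def B_def intro!: derivative_eq_intros)
  have BA: "(B w)\<^sup>2 - (A w)\<^sup>2 = \<epsilon>" for w
    using assms(2) by (auto simp: A_def B_def \<epsilon>_def cosh_square_eq)
  have eps: "\<epsilon> = 1 \<or> \<epsilon> = -1"
    using assms(2) by (auto simp: \<epsilon>_def)
  have "\<sigma> * \<sigma> = ((-1) * (-1)) ^ fact (4 - j) * (\<epsilon> * \<epsilon>) ^ j"
    unfolding \<sigma>_def \<epsilon>_def power_mult_distrib by (simp add: algebra_simps)
  then have sigma: "\<sigma> * \<sigma> = 1"
    using eps by auto
  have UI: "p $ 1 \<in> I" if "p \<in> U" for p
    using assms(10) that by blast
  have orth: "mink (F a s) (F b s) = (if a \<noteq> b then 0 else if a = j then -1 else 1)"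
    if "s \<in> I" "a \<in> {1..4}" "b \<in> {1..4}" for a b s
    using assms(7) that unfolding frenet_curve_def by blast
  have dk: "(k 1 has_real_derivative deriv (k 1) s) (at s)" if "s \<in> I" for s
    using assms(7) that smooth_on_has_real_derivative [of I "k 1" s] by (simp add: frenet_curve_def)
  have d: "(\<beta> has_vector_derivative F 1 s) (at s)"
    "(F 1 has_vector_derivative k 1 s *\<^sub>R F 2 s) (at s)" if "s \<in> I" for s
    using assms(7) that unfolding frenet_curve_def by blast+
  have tube_normal: "tube_normal j lam F p = \<sigma> *\<^sub>R (\<Sum>i=2..4. mu j lam i (p$2) (p$3) *\<^sub>R F i (p$1))" for p
    by (simp add: tube_normal_def \<sigma>_def)
  consider "j = 2" | "j = 3" | "j = 4"
    using assms(1) by blast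
  then show ?thesis
  proof cases
    case 1
    have dF: "(F 2 has_vector_derivative k 1 s *\<^sub>R F 1 s + k 2 s *\<^sub>R F 3 s) (at s)"
      "(F 3 has_vector_derivative k 2 s *\<^sub>R F 2 s + k 3 s *\<^sub>R F 4 s) (at s)"
      "(F 4 has_vector_derivative - k 3 s *\<^sub>R F 3 s) (at s)" if "s \<in> I" for s
      using assms(7) that 1 by (simp_all add: frenet_curve_def)
    \<comment> \<open>Here \<open>F 2\<close> is \<open>P\<close>; comparing the derivative of
      \<open>F 3\<close> with \<open>dQ\<close> gives \<open>\<omega>QR = - k 3\<close>.\<close>
    have frame: "framed_tube A B I U r \<sigma> \<epsilon> \<beta> (F 1) (F 2) (F 3) (F 4) (k 1) (\<lambda>_. 0) (\<lambda>_. 0)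
        (deriv (k 1)) (\<lambda>_. 0) (\<lambda>_. 0) (k 2) (\<lambda>_. 0) (\<lambda>s. - k 3 s)"
      by (intro framed_tube.intro framed_tube_axioms.intro hyp BA eps sigma \<open>r > 0\<close> \<open>open U\<close> UI dk)
        (use d dF 1 in \<open>simp_all add: orth\<close>)
    show ?thesis
      by (rule no_second_kind_framed_tube [OF frame assms(11)])
        (unfold fun_eq_iff tube_normal tube_def framed_tube.X_def [OF frame]
          framed_tube.N_def [OF frame] framed_tube.n_def [OF frame] sum_2_to_4,
         unfold 1 mu,
         simp_all add: algebra_simps)
  next
    case 2
    have dF: "(F 2 has_vector_derivative - k 1 s *\<^sub>R F 1 s + k 2 s *\<^sub>R F 3 s) (at s)"
      "(F 3 has_vector_derivative k 2 s *\<^sub>R F 2 s + k 3 s *\<^sub>R F 4 s) (at s)"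
      "(F 4 has_vector_derivative k 3 s *\<^sub>R F 3 s) (at s)" if "s \<in> I" for s
      using assms(7) that 2 by (simp_all add: frenet_curve_def)
    \<comment> \<open>Here \<open>F 2\<close> is \<open>R\<close>, and \<open>kR = - k 1\<close>
      because \<open>kR\<close> enters \<open>dT\<close> with a minus sign.\<close>
    have frame: "framed_tube A B I U r \<sigma> \<epsilon> \<beta> (F 1) (F 3) (F 4) (F 2) (\<lambda>_. 0) (\<lambda>_. 0) (\<lambda>s. - k 1 s)
        (\<lambda>_. 0) (\<lambda>_. 0) (\<lambda>s. - deriv (k 1) s) (k 3) (k 2) (\<lambda>_. 0)"
      by (intro framed_tube.intro framed_tube_axioms.intro hyp BA eps sigma \<open>r > 0\<close> \<open>open U\<close> UI
          dk DERIV_minus)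
        (use d dF 2 in \<open>simp_all add: orth add.commute\<close>)
    show ?thesis
      by (rule no_second_kind_framed_tube [OF frame assms(11)])
        (unfold fun_eq_iff tube_normal tube_def framed_tube.X_def [OF frame]
          framed_tube.N_def [OF frame] framed_tube.n_def [OF frame] sum_2_to_4,
         unfold 2 mu,
         simp_all add: algebra_simps)
  next
    case 3
    have dF: "(F 2 has_vector_derivative - k 1 s *\<^sub>R F 1 s + k 2 s *\<^sub>R F 3 s) (at s)"
      "(F 3 has_vector_derivative - k 2 s *\<^sub>R F 2 s + k 3 s *\<^sub>R F 4 s) (at s)"
      "(F 4 has_vector_derivative k 3 s *\<^sub>R F 3 s) (at s)" if "s \<in> I" for s
      using assms(7) that 3 by (simp_all add: frenet_curve_def)
    \<comment> \<open>Here \<open>F 2\<close> is \<open>Q\<close>, hence \<open>kQ = - k 1\<close>;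
      its derivative gives \<open>\<omega>QR = - k 2\<close>.\<close>
    have frame: "framed_tube A B I U r \<sigma> \<epsilon> \<beta> (F 1) (F 4) (F 2) (F 3) (\<lambda>_. 0) (\<lambda>s. - k 1 s) (\<lambda>_. 0)
        (\<lambda>_. 0) (\<lambda>s. - deriv (k 1) s) (\<lambda>_. 0) (\<lambda>_. 0) (k 3) (\<lambda>s. - k 2 s)"
      by (intro framed_tube.intro framed_tube_axioms.intro hyp BA eps sigma \<open>r > 0\<close> \<open>open U\<close> UI
          dk DERIV_minus)
        (use d dF 3 in \<open>simp_all add: orth add.commute\<close>)
    show ?thesis
      by (rule no_second_kind_framed_tube [OF frame assms(11)])
        (unfold fun_eq_iff tube_normal tube_def framed_tube.X_def [OF frame]
          framed_tube.N_def [OF frame] framed_tube.n_def [OF frame] sum_2_to_4,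
         unfold 3 mu,
         simp_all add: algebra_simps)
  qed
qed

end
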